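(* Let $T$ be an alternation acyclic tournament on $\{1,\ldots,n\}$, and let $\pi$ be any linear extension of the right-alternating walk order $\preceq$ induced by $T$ (i.e. a permutation of $\{1,\ldots,n\}$ with $\pi^{-1}(u)\le \pi^{-1}(v)$ whenever $u\preceq v$). Then there is a unique function $p:\{1,\ldots,n\}\to\{2,\ldots,n\}\cup\{\infty\}$ satisfying $p(i)>i$ for all $i$ such that $T(\pi,p)=T$.
   Context: A tournament on $\{1,\ldots,n\}$ has, for each pair $i\neq j$, exactly one of the arcs $i\to j$, $j\to i$. An arc $i\to j$ is an ascent if $i<j$ and a descent if $i>j$. A tournament is alternation acyclic if it has no directed cycle along which ascents and descents alternate. The right-alternating walk relation: $u\preceq v$ if $u=v$ or there is a directed walk $u=w_0\to w_1\to\cdots\to w_{2i}=v$ ($i\ge1$) whose arcs $w_{2r}\to w_{2r+1}$ are descents and $w_{2r+1}\to w_{2r+2}$ are ascents; for alternation acyclic $T$ this is a partial order. For a permutation $\pi$ and such a $p$, $T(\pi,p)$ is the tournament in which, for all $u<v$, $u\to v$ if $p(u)\neq\infty$ and $\pi^{-1}(v)\geq\pi^{-1}(p(u))$, and $v\to u$ otherwise. *)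

theory Defs
  imports "HOL-Combinatorics.Permutations" "HOL-Library.Extended_Nat" "HOL-Library.FuncSet"
begin

text \<open>A digraph is given by its set of arcs, where \<open>(i, j) \<in> T\<close> means \<open>i \<rightarrow> j\<close>.\<close>

definition tournament :: "nat \<Rightarrow> (nat \<times> nat) set \<Rightarrow> bool" where
  "tournament n T \<longleftrightarrow>
     T \<subseteq> {1..n} \<times> {1..n} \<and>
     (\<forall>i\<in>{1..n}. (i, i) \<notin> T) \<and>
     (\<forall>i\<in>{1..n}. \<forall>j\<in>{1..n}. i \<noteq> j \<longrightarrow> ((i, j) \<in> T) \<noteq> ((j, i) \<in> T))"

definition ascents :: "(nat \<times> nat) set \<Rightarrow> (nat \<times> nat) set" where
  "ascents T = {(i, j) \<in> T. i < j}"

definition descents :: "(nat \<times> nat) set \<Rightarrow> (nat \<times> nat) set" where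
  "descents T = {(i, j) \<in> T. i > j}"

text \<open>The list \<open>cs\<close> contains the vertices in cyclic order, without repeating the first one at
  the end.\<close>

definition cycle_arc :: "nat list \<Rightarrow> nat \<Rightarrow> nat \<times> nat" where
  "cycle_arc cs i = (cs ! (i mod length cs), cs ! (Suc i mod length cs))"

definition directed_cycle :: "(nat \<times> nat) set \<Rightarrow> nat list \<Rightarrow> bool" where
  "directed_cycle T cs \<longleftrightarrow>
     cs \<noteq> [] \<and> distinct cs \<and> (\<forall>i<length cs. cycle_arc cs i \<in> T)"

text \<open>Alternation is required cyclically: also between the closing arc and the first arc
  (case \<open>i = length cs - 1\<close>).\<close>

definition alternating_cycle :: "(nat \<times> nat) set \<Rightarrow> nat list \<Rightarrow> bool" where
  "alternating_cycle T cs \<longleftrightarrow>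
     directed_cycle T cs \<and>
     (\<forall>i<length cs.
        cycle_arc cs i \<in> ascents T \<and> cycle_arc cs (Suc i) \<in> descents T \<or>
        cycle_arc cs i \<in> descents T \<and> cycle_arc cs (Suc i) \<in> ascents T)"

definition alternation_acyclic :: "nat \<Rightarrow> (nat \<times> nat) set \<Rightarrow> bool" where
  "alternation_acyclic n T \<longleftrightarrow> tournament n T \<and> (\<nexists>cs. alternating_cycle T cs)"

definition right_alt_le :: "(nat \<times> nat) set \<Rightarrow> nat \<Rightarrow> nat \<Rightarrow> bool" where
  "right_alt_le T u v \<longleftrightarrow>
     u = v \<or>
     (\<exists>i\<ge>1. \<exists>w :: nat \<Rightarrow> nat. w 0 = u \<and> w (2 * i) = v \<and>
        (\<forall>r<i. (w (2 * r), w (2 * r + 1)) \<in> descents T \<and>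
               (w (2 * r + 1), w (2 * r + 2)) \<in> ascents T))"

definition linear_extension :: "nat \<Rightarrow> (nat \<times> nat) set \<Rightarrow> (nat \<Rightarrow> nat) \<Rightarrow> bool" where
  "linear_extension n T \<pi> \<longleftrightarrow>
     \<pi> permutes {1..n} \<and>
     (\<forall>u\<in>{1..n}. \<forall>v\<in>{1..n}. right_alt_le T u v \<longrightarrow> inv \<pi> u \<le> inv \<pi> v)"

text \<open>Functions into \<open>{2,\<dots>,n} \<union> {\<infinity>}\<close> take values in \<^typ>\<open>enat\<close>. Membership in \<open>\<rightarrow>\<^sub>E\<close> fixes
  \<open>p\<close> outside \<open>{1..n}\<close>, so that uniqueness of \<open>p\<close> means uniqueness of its restriction.\<close>

definition T_maps :: "nat \<Rightarrow> (nat \<Rightarrow> enat) set" where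
  "T_maps n = {p \<in> {1..n} \<rightarrow>\<^sub>E (enat ` {2..n} \<union> {\<infinity>}). \<forall>i\<in>{1..n}. p i > enat i}"

definition T_ascent :: "(nat \<Rightarrow> nat) \<Rightarrow> (nat \<Rightarrow> enat) \<Rightarrow> nat \<Rightarrow> nat \<Rightarrow> bool" where
  "T_ascent \<pi> p u v \<longleftrightarrow> p u \<noteq> \<infinity> \<and> inv \<pi> v \<ge> inv \<pi> (the_enat (p u))"

definition T_of :: "nat \<Rightarrow> (nat \<Rightarrow> nat) \<Rightarrow> (nat \<Rightarrow> enat) \<Rightarrow> (nat \<times> nat) set" where
  "T_of n \<pi> p =
     {(u, v). u \<in> {1..n} \<and> v \<in> {1..n} \<and> u < v \<and> T_ascent \<pi> p u v} \<union>
     {(v, u). u \<in> {1..n} \<and> v \<in> {1..n} \<and> u < v \<and> \<not> T_ascent \<pi> p u v}"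

end

theory Submission
  imports Defs
begin

text \<open>If \<open>u \<rightarrow> v\<close> is an ascent and \<open>w \<rightarrow> u\<close> a descent, then \<open>w \<rightarrow> u \<rightarrow> v\<close> is a right-alternating walk,
  so \<open>\<pi>\<close> lists \<open>w\<close> before \<open>v\<close>. Hence the heads of the ascents leaving \<open>u\<close> are exactly the vertices above
  \<open>u\<close> that \<open>\<pi>\<close> lists from some point on, and \<open>p u\<close> has to be the first of these heads, or \<open>\<infinity>\<close> if there
  is none.\<close>

lemma T_of_ascent_iff:
  assumes "u \<in> {1..n}" "v \<in> {1..n}" "u < v"
  shows "(u, v) \<in> T_of n \<pi> p \<longleftrightarrow> T_ascent \<pi> p u v"
  using assms by (auto simp: T_of_def)

lemma tournament_T_of: "tournament n (T_of n \<pi> p)"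
  unfolding tournament_def T_of_def by auto

text \<open>A tournament is determined by its ascents: there are no loops, and for
  \<open>u < v\<close> the arc \<open>(v, u)\<close> is present exactly when \<open>(u, v)\<close>
  is absent.\<close>

lemma tournament_eqI:
  assumes "tournament n S" "tournament n T"
    and "\<And>u v. u \<in> {1..n} \<Longrightarrow> v \<in> {1..n} \<Longrightarrow> u < v \<Longrightarrow> (u, v) \<in> S \<longleftrightarrow> (u, v) \<in> T"
  shows "S = T"
proof -
  have "(u, v) \<in> S \<longleftrightarrow> (u, v) \<in> T" if "u \<in> {1..n}" "v \<in> {1..n}" for u v
    using assms that unfolding tournament_def by (metis linorder_cases)
  then show ?thesis
    using assms(1,2) unfolding tournament_def by blast
qed

lemma T_maps_enatD:
  assumes "p \<in> T_maps n" "u \<in> {1..n}" "p u = enat a"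
  shows "a \<in> {1..n}" "u < a"
proof -
  have "p u \<in> enat ` {2..n} \<union> {\<infinity>}" "p u > enat u"
    using assms(1,2) unfolding T_maps_def by (blast dest: PiE_mem)+
  then show "a \<in> {1..n}" "u < a"
    using assms(3) by auto
qed

text \<open>The value \<open>a\<close> of \<open>p\<close> at \<open>u\<close> is itself the head of
  an ascent leaving \<open>u\<close>, since its position trivially meets the bound in
  \<open>T_ascent\<close>. The same arc, read through \<open>q\<close>, forces \<open>q u\<close> to
  be finite and listed no later than \<open>a\<close>.\<close>

lemma T_of_eq_imp_le:
  assumes "p \<in> T_maps n" "T_of n \<pi> p = T_of n \<pi> q" "u \<in> {1..n}" "p u = enat a"
  obtains b where "q u = enat b" "inv \<pi> b \<le> inv \<pi> a"
proof -
  note a = T_maps_enatD[OF assms(1,3,4)]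
  have "T_ascent \<pi> p u a"
    using assms(4) by (simp add: T_ascent_def)
  then have "T_ascent \<pi> q u a"
    using T_of_ascent_iff[OF assms(3) a] assms(2) by metis
  then show thesis
    using that by (auto simp: T_ascent_def)
qed

lemma T_of_inj_on:
  assumes "\<pi> permutes {1..n}"
  shows "inj_on (T_of n \<pi>) (T_maps n)"
proof (rule inj_onI)
  fix p q assume p: "p \<in> T_maps n" and q: "q \<in> T_maps n" and eq: "T_of n \<pi> p = T_of n \<pi> q"
  have inj: "inj (inv \<pi>)"
    using permutes_inj[OF permutes_inv[OF assms]] .
  show "p = q"
  proof (rule PiE_ext)
    show "p \<in> {1..n} \<rightarrow>\<^sub>E (enat ` {2..n} \<union> {\<infinity>})" "q \<in> {1..n} \<rightarrow>\<^sub>E (enat ` {2..n} \<union> {\<infinity>})"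
      using p q by (simp_all add: T_maps_def)
  next
    fix u assume u: "u \<in> {1..n}"
    \<comment> \<open>The comparison is used in both directions; positions are then equal, and
      injectivity of \<open>inv \<pi>\<close> identifies the values.\<close>
    note pq = T_of_eq_imp_le[OF p eq u] and qp = T_of_eq_imp_le[OF q eq[symmetric] u]
    show "p u = q u"
    proof (cases "p u")
      case (enat a)
      obtain b where b: "q u = enat b" "inv \<pi> b \<le> inv \<pi> a"
        using pq[OF enat] .
      have "inv \<pi> a \<le> inv \<pi> b"
        using qp[OF b(1)] enat by auto
      then have "a = b"
        using b(2) inj by (simp add: inj_eq)
      then show ?thesis
        using enat b(1) by simp
    next
      case infinity
      then show ?thesis
        \<comment> \<open>A finite \<open>q u\<close> would make \<open>p u\<close> finite as
          well.\<close>
        using qp by (cases "q u") auto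
    qed
  qed
qed

text \<open>If \<open>u \<rightarrow> w\<close> failed, the walk
  \<open>w \<rightarrow> u \<rightarrow> v\<close> would put \<open>w\<close> no later than
  \<open>v\<close>, so both would share a position and \<open>w = v\<close>, although
  \<open>u \<rightarrow> v\<close> holds.\<close>

lemma linear_extension_ascent_upward:
  assumes "tournament n T" "linear_extension n T \<pi>"
    and uv: "(u, v) \<in> T" "u < v"
    and w: "w \<in> {1..n}" "u < w" "inv \<pi> v \<le> inv \<pi> w"
  shows "(u, w) \<in> T"
proof (rule ccontr)
  assume "(u, w) \<notin> T"
  moreover have "u \<noteq> w"
    using w(2) by simp
  moreover have mem: "u \<in> {1..n}" "v \<in> {1..n}"
    using assms(1) uv(1) unfolding tournament_def by blast+
  ultimately have "(w, u) \<in> T"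
    using assms(1) w(1) unfolding tournament_def by blast
  then have arcs: "(w, u) \<in> descents T" "(u, v) \<in> ascents T"
    using uv w(2) by (simp_all add: descents_def ascents_def)
  have "right_alt_le T w v"
    unfolding right_alt_le_def
  \<comment> \<open>The walk has \<open>i = 1\<close>; only the indices 0, 1 and 2 of the list are
    ever read.\<close>
  proof (intro disjI2 exI conjI)
    show "\<forall>r<1. ([w, u, v] ! (2 * r), [w, u, v] ! (2 * r + 1)) \<in> descents T \<and>
        ([w, u, v] ! (2 * r + 1), [w, u, v] ! (2 * r + 2)) \<in> ascents T"
      using arcs by simp
  qed simp_all
  then have "inv \<pi> w \<le> inv \<pi> v"
    using assms(2) mem(2) w(1) unfolding linear_extension_def by blast
  with w(3) have "inv \<pi> w = inv \<pi> v"
    by simp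
  moreover have "inj (inv \<pi>)"
    using assms(2) unfolding linear_extension_def by (blast intro: permutes_inj permutes_inv)
  ultimately have "w = v"
    by (simp add: inj_eq)
  with uv \<open>(u, w) \<notin> T\<close> show False
    by simp
qed

lemma ex_T_map:
  assumes T: "tournament n T" and ext: "linear_extension n T \<pi>"
  shows "\<exists>p \<in> T_maps n. T_of n \<pi> p = T"
proof -
  define A where "A u = {v. (u, v) \<in> T \<and> u < v}" for u
  define m where "m u = arg_min_on (inv \<pi>) (A u)" for u
  \<comment> \<open>For empty \<open>A u\<close> the value \<open>m u\<close> is arbitrary, hence
    the case split. The restriction to \<open>{1..n}\<close> supplies the extensionality demanded by
    \<open>T_maps\<close>.\<close>
  define p where "p = (\<lambda>u\<in>{1..n}. if A u = {} then \<infinity> else enat (m u))"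
  have A_sub: "A u \<subseteq> {1..n}" for u
    using T unfolding A_def tournament_def by blast
  then have fin: "finite (A u)" for u
    by (rule finite_subset) simp
  have m_in: "m u \<in> A u" if "A u \<noteq> {}" for u
    unfolding m_def using fin that by (rule arg_min_if_finite(1))
  have m_le: "inv \<pi> (m u) \<le> inv \<pi> v" if "v \<in> A u" for u v
    unfolding m_def using arg_min_least[OF fin] that by blast
  have "p u \<in> enat ` {2..n} \<union> {\<infinity>} \<and> enat u < p u" if "u \<in> {1..n}" for u
  proof (cases "A u = {}")
    case False
    then have "m u \<in> {1..n}" "u < m u"
      using m_in[OF False] A_sub[of u] by (auto simp: A_def)
    then show ?thesis
      \<comment> \<open>The lower bound 2 comes from \<open>m u > u \<ge> 1\<close>.\<close>
      using that False by (auto simp: p_def)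
  qed (use that in \<open>simp add: p_def\<close>)
  then have "p \<in> T_maps n"
    by (auto simp: T_maps_def PiE_iff p_def)
  moreover have "T_of n \<pi> p = T"
  proof (rule tournament_eqI[OF tournament_T_of T])
    fix u v assume uv: "u \<in> {1..n}" "v \<in> {1..n}" "u < v"
    have "T_ascent \<pi> p u v \<longleftrightarrow> A u \<noteq> {} \<and> inv \<pi> (m u) \<le> inv \<pi> v"
      using uv by (simp add: T_ascent_def p_def)
    \<comment> \<open>Forwards, the ascent to \<open>m u\<close> propagates to every later vertex
      above \<open>u\<close>; backwards, \<open>m u\<close> has the least position in
      \<open>A u\<close>.\<close>
    also have "\<dots> \<longleftrightarrow> (u, v) \<in> T"
    proof
      assume "A u \<noteq> {} \<and> inv \<pi> (m u) \<le> inv \<pi> v"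
      then show "(u, v) \<in> T"
        using linear_extension_ascent_upward[OF T ext _ _ uv(2,3)] m_in[of u]
        unfolding A_def by blast
    next
      assume "(u, v) \<in> T"
      then have "v \<in> A u"
        using uv by (simp add: A_def)
      then show "A u \<noteq> {} \<and> inv \<pi> (m u) \<le> inv \<pi> v"
        using m_le by blast
    qed
    finally show "(u, v) \<in> T_of n \<pi> p \<longleftrightarrow> (u, v) \<in> T"
      using T_of_ascent_iff[OF uv] by simp
  qed
  ultimately show ?thesis
    by blast
qed

theorem theorem3p8:
  fixes n :: nat and T :: "(nat \<times> nat) set" and \<pi> :: "nat \<Rightarrow> nat"
  assumes "alternation_acyclic n T"
    and "linear_extension n T \<pi>"
  shows "\<exists>!p. p \<in> T_maps n \<and> T_of n \<pi> p = T"
proof (rule ex_ex1I)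
  show "\<exists>p. p \<in> T_maps n \<and> T_of n \<pi> p = T"
    using ex_T_map[of n T \<pi>] assms unfolding alternation_acyclic_def by blast
next
  have "inj_on (T_of n \<pi>) (T_maps n)"
    using assms(2) by (intro T_of_inj_on) (simp add: linear_extension_def)
  then show "p = q" if "p \<in> T_maps n \<and> T_of n \<pi> p = T" "q \<in> T_maps n \<and> T_of n \<pi> q = T" for p q
    using that by (auto dest: inj_onD)
qed

end
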